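(* Let $f:\mathbb{R}^d\to\mathbb{R}$ be convex with nonempty set of minimizers. Suppose the first-order method $\mathtt{fom}(\epsilon)$ satisfies the decrement guarantee with a function $K_{\mathtt{dec}}$, and $f$ satisfies the growth condition with a function $G$ (both defined in the context). Let $\{\epsilon_k\}_{k\ge0}$ be any strictly increasing sequence of positive reals with $\epsilon_k\to\infty$, $N_0\ge1$ an integer, $\Delta_0=f(x^{(0)})-f_\star$ and $m=\inf\{k:\epsilon_k\ge\Delta_0/2\}$. If for every $\epsilon>0$ the function $\delta\mapsto K_{\mathtt{dec}}(\epsilon,\delta,G^{-1}(\delta))$ is nonincreasing on $[2\epsilon,+\infty)$, then the Dynamic Restarting Scheme (described in the context), run from $x^{(0)}$ with targets $\{\epsilon_k\}$ and initial process count $N_0$, computes a $(2\epsilon_0)$-optimal solution no later than round $$\sum_{k=0}^{m-1}\left(1+\frac{2\epsilon_{k+1}}{\epsilon_k}\right)K_{\mathtt{dec}}\left(\epsilon_k,2\epsilon_k,G^{-1}(2\epsilon_k)\right).$$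
   Context: Notation: $f_\star=\min f$, $X_\star=\operatorname{argmin} f\neq\emptyset$, $\operatorname{dist}(y,X_\star)=\inf_{x\in X_\star}\|y-x\|_2$. A sum over an empty set is $0$. A point $x$ is $\eta$-optimal if $f(x)-f_\star\le\eta$; "computes an $\eta$-optimal solution no later than round $T$" means that for some integer $0\le t\le T$ the point $\overline x^{(t)}$ defined below is $\eta$-optimal. First-order method. $\mathtt{fom}(\epsilon)$, $\epsilon>0$, is a deterministic iterative method which from any initial point $x^{(0)}$ generates iterates $x^{(1)},x^{(2)},\dots$ sequentially. Decrement guarantee. There is a non-negative finite-valued function $K_{\mathtt{dec}}(\epsilon,\delta,D)$ such that for all $\delta\ge 2\epsilon>0$, $D>0$ and every initial point $x^{(0)}$ with $f(x^{(0)})-f_\star\ge\delta$ and $\operatorname{dist}(x^{(0)},X_\star)\le D$, the iterates of $\mathtt{fom}(\epsilon)$ satisfy $\min\{f(x^{(k)}):0\le k\le K_{\mathtt{dec}}(\epsilon,\delta,D)\}\le f(x^{(0)})-\epsilon$. As a standing convention (without loss of generality), $K_{\mathtt{dec}}$ is nonincreasing in $\delta$ and nondecreasing in $D$. Growth condition. There is a strictly increasing invertible $G:[0,\infty)\to[0,\infty)$ with $f(x)-f_\star\ge G(\operatorname{dist}(x,X_\star))$ for all $x$ with $f(x)\le f(x^{(0)})$, where $x^{(0)}$ is the initialization of the scheme. Dynamic Restarting Scheme. Input: $x^{(0)}$, targets $\{\epsilon_k\}_{k\ge0}$, $\mathtt{fom}$, and $N_0\ge1$ (default $1$). Process $P_k$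 runs $\mathtt{fom}(\epsilon_k)$ and stores a reference point; its task is to obtain a point $\overline x$ with $f(\overline x)\le f(\text{reference point of }P_k)-\epsilon_k$. Round $0$: set $\overline x^{(0)}=x^{(0)}$ and launch $P_0,\dots,P_{N_0-1}$, each with initial point and reference point $x^{(0)}$. Round $t=1,2,\dots$: (Step 1) every process currently in the scheme runs one iteration; let $\overline x^{(t)}$ be an iterate with minimum objective value among all new iterates of this round. (Step 2) For each process $P_k$ that was in the scheme at the beginning of round $t$: if $\overline x^{(t)}$ accomplishes the task of $P_k$, then $P_k$ is restarted at $\overline x^{(t)}$ (its memory is cleared, it then behaves as $\mathtt{fom}(\epsilon_k)$ started from $\overline x^{(t)}$, and its reference point becomes $\overline x^{(t)}$); if moreover $P_k$ is the highest-indexed process entering round $t$, a new process $P_{k+1}$ is launched with initial point and reference point $\overline x^{(t)}$ (its first iteration occurs in round $t+1$). Otherwise $P_k$ continues unchanged. *)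

theory Defs
  imports "HOL-Analysis.Analysis"
begin

definition minimizers :: "('a \<Rightarrow> real) \<Rightarrow> 'a set" where
  "minimizers f = {x. is_arg_min f (\<lambda>_. True) x}"

text \<open>The minimum of \<open>f\<close>; only used when \<open>minimizers f\<close> is nonempty, so the infimum is attained.\<close>

definition min_value :: "('a \<Rightarrow> real) \<Rightarrow> real" where
  "min_value f = (INF x. f x)"

definition eta_optimal :: "('a \<Rightarrow> real) \<Rightarrow> real \<Rightarrow> 'a \<Rightarrow> bool" where
  "eta_optimal f \<eta> x \<longleftrightarrow> f x - min_value f \<le> \<eta>"

text \<open>A deterministic iterative method is identified with the map sending the parameter
  \<open>\<epsilon>\<close>, the initial point \<open>x\<close> and an index \<open>k\<close> to the \<open>k\<close>-th iterate.  The objective is fixed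
  throughout, so its influence on the iterates is left implicit in \<open>fom\<close>.\<close>

type_synonym 'a fom = "real \<Rightarrow> 'a \<Rightarrow> nat \<Rightarrow> 'a"

definition first_order_method :: "'a fom \<Rightarrow> bool" where
  "first_order_method fom \<longleftrightarrow> (\<forall>\<epsilon>>0. \<forall>x. fom \<epsilon> x 0 = x)"

text \<open>The bound \<open>K \<epsilon> \<delta> D\<close> is a real number, not necessarily an integer.  All conditions on
  \<open>K\<close> are imposed only for \<open>\<delta> \<ge> 2 * \<epsilon> > 0\<close> and \<open>D > 0\<close>.\<close>

definition decrement_guarantee ::
    "('a::metric_space \<Rightarrow> real) \<Rightarrow> 'a fom \<Rightarrow> (real \<Rightarrow> real \<Rightarrow> real \<Rightarrow> real) \<Rightarrow> bool" where
  "decrement_guarantee f fom K \<longleftrightarrow>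
     (\<forall>\<epsilon> \<delta> D. \<epsilon> > 0 \<and> \<delta> \<ge> 2 * \<epsilon> \<and> D > 0 \<longrightarrow>
        K \<epsilon> \<delta> D \<ge> 0 \<and>
        (\<forall>x. f x - min_value f \<ge> \<delta> \<and> infdist x (minimizers f) \<le> D \<longrightarrow>
           Min ((\<lambda>k. f (fom \<epsilon> x k)) ` {k. real k \<le> K \<epsilon> \<delta> D}) \<le> f x - \<epsilon>))"

definition monotone_rate :: "(real \<Rightarrow> real \<Rightarrow> real \<Rightarrow> real) \<Rightarrow> bool" where
  "monotone_rate K \<longleftrightarrow>
     (\<forall>\<epsilon>>0. \<forall>D>0. antimono_on {2 * \<epsilon>..} (\<lambda>\<delta>. K \<epsilon> \<delta> D)) \<and>
     (\<forall>\<epsilon>>0. \<forall>\<delta>\<ge>2 * \<epsilon>. mono_on {0<..} (\<lambda>D. K \<epsilon> \<delta> D))"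

definition growth_condition ::
    "('a::metric_space \<Rightarrow> real) \<Rightarrow> (real \<Rightarrow> real) \<Rightarrow> 'a \<Rightarrow> bool" where
  "growth_condition f G x0 \<longleftrightarrow>
     strict_mono_on {0..} G \<and> bij_betw G {0..} {0..} \<and>
     (\<forall>x. f x \<le> f x0 \<longrightarrow> f x - min_value f \<ge> G (infdist x (minimizers f)))"

abbreviation growth_inverse :: "(real \<Rightarrow> real) \<Rightarrow> real \<Rightarrow> real" where
  "growth_inverse G \<equiv> inv_into {0..} G"

text \<open>Whenever a process is launched or restarted, its initial point and its reference point are
  set to the same point, so one field records both; \<open>age\<close> counts the iterations since then.
  In a list of processes, the entry at position \<open>k\<close> is the process running \<open>fom (\<epsilon> k)\<close>.\<close>

datatype 'a process = Process (reference: 'a) (age: nat)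

definition accomplishes_task :: "('a \<Rightarrow> real) \<Rightarrow> real \<Rightarrow> 'a process \<Rightarrow> 'a \<Rightarrow> bool" where
  "accomplishes_task f \<epsilon> P x \<longleftrightarrow> f x \<le> f (reference P) - \<epsilon>"

definition new_iterates :: "'a fom \<Rightarrow> (nat \<Rightarrow> real) \<Rightarrow> 'a process list \<Rightarrow> 'a set" where
  "new_iterates fom \<epsilon> ps =
     {fom (\<epsilon> k) (reference (ps ! k)) (Suc (age (ps ! k))) | k. k < length ps}"

definition update_process ::
    "('a \<Rightarrow> real) \<Rightarrow> real \<Rightarrow> 'a \<Rightarrow> 'a process \<Rightarrow> 'a process" where
  "update_process f \<epsilon> x P =
     (if accomplishes_task f \<epsilon> P x then Process x 0
      else Process (reference P) (Suc (age P)))"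

definition next_processes ::
    "('a \<Rightarrow> real) \<Rightarrow> (nat \<Rightarrow> real) \<Rightarrow> 'a \<Rightarrow> 'a process list \<Rightarrow> 'a process list" where
  "next_processes f \<epsilon> x ps =
     map (\<lambda>k. update_process f (\<epsilon> k) x (ps ! k)) [0..<length ps] @
     (if accomplishes_task f (\<epsilon> (length ps - 1)) (last ps) x then [Process x 0] else [])"

text \<open>\<open>procs t\<close> is the list of processes at the end of round \<open>t\<close>, i.e. entering round \<open>t + 1\<close>.
  The scheme leaves open which minimizing iterate is chosen when there are ties; a run is any
  sequence of rounds compatible with its rules.\<close>

definition dynamic_restarting_run ::
    "('a \<Rightarrow> real) \<Rightarrow> 'a fom \<Rightarrow> (nat \<Rightarrow> real) \<Rightarrow> nat \<Rightarrow> 'a \<Rightarrow>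
     (nat \<Rightarrow> 'a) \<Rightarrow> (nat \<Rightarrow> 'a process list) \<Rightarrow> bool" where
  "dynamic_restarting_run f fom \<epsilon> N0 x0 xbar procs \<longleftrightarrow>
     xbar 0 = x0 \<and> procs 0 = replicate N0 (Process x0 0) \<and>
     (\<forall>t. is_arg_min f (\<lambda>y. y \<in> new_iterates fom \<epsilon> (procs t)) (xbar (Suc t)) \<and>
          procs (Suc t) = next_processes f \<epsilon> (xbar (Suc t)) (procs t))"

definition computes_by_round ::
    "('a \<Rightarrow> real) \<Rightarrow> (nat \<Rightarrow> 'a) \<Rightarrow> real \<Rightarrow> real \<Rightarrow> bool" where
  "computes_by_round f xbar \<eta> T \<longleftrightarrow> (\<exists>t. real t \<le> T \<and> eta_optimal f \<eta> (xbar t))"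

end

theory Submission
  imports Defs
begin

text \<open>
  While the gap of the reference point of \<open>P\<^sub>k\<close> is at least \<open>2\<epsilon>\<^sub>k\<close>, the growth condition bounds its
  distance to the minimizers, so \<open>P\<^sub>k\<close> restarts within
  \<open>\<kappa>\<^sub>k = K \<epsilon>\<^sub>k (2\<epsilon>\<^sub>k) (G\<^sup>-\<^sup>1 (2\<epsilon>\<^sub>k))\<close> rounds.  Hence within \<open>\<Sum>k<j. \<kappa>\<^sub>k\<close> rounds (the summand \<open>1\<close> in the
  bound) either \<open>P\<^sub>j\<close> has been launched or some earlier \<open>P\<^sub>i\<close> already has gap below \<open>2\<epsilon>\<^sub>i\<close>.
  Afterwards the gap descends along the indices: a reference point of \<open>P\<^sub>k\<^sub>+\<^sub>1\<close> was also offered to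
  \<open>P\<^sub>k\<close>, so once \<open>P\<^sub>k\<^sub>+\<^sub>1\<close> has gap below \<open>2\<epsilon>\<^sub>k\<^sub>+\<^sub>1\<close>, the gap of \<open>P\<^sub>k\<close> is below \<open>2\<epsilon>\<^sub>k\<^sub>+\<^sub>1 + \<epsilon>\<^sub>k\<close>, and at most
  \<open>2\<epsilon>\<^sub>k\<^sub>+\<^sub>1 / \<epsilon>\<^sub>k\<close> restarts of \<open>P\<^sub>k\<close> bring it below \<open>2\<epsilon>\<^sub>k\<close>.
\<close>

section \<open>Growth inverse and decrement guarantee\<close>

lemma growth_inverse_pos:
  assumes "strict_mono_on {0..} G" "bij_betw G {0..} {0..}" "\<delta> > 0"
  shows "growth_inverse G \<delta> > 0"
proof -
  have img: "G ` {0..} = {0..}"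
    using assms(2) by (simp add: bij_betw_def)
  \<comment> \<open>Hence a preimage of a positive \<open>\<delta>\<close> is not \<open>0\<close>.
    Positivity matters because the decrement guarantee speaks only of \<open>D > 0\<close>, and
    \<open>growth_inverse G \<delta>\<close> will serve as \<open>D\<close>.\<close>
  have "G 0 = 0"
  proof (rule antisym)
    have "0 \<in> G ` {0..}"
      using img by simp
    then obtain y where "y \<ge> 0" "G y = 0"
      by auto
    then show "G 0 \<le> 0"
      using strict_mono_onD[OF assms(1), of 0 y] by (cases "y = 0") auto
    show "G 0 \<ge> 0"
      using img by (auto simp: set_eq_iff image_iff)
  qed
  moreover have "\<delta> \<in> G ` {0..}"
    using img assms(3) by simp
  then have "G (growth_inverse G \<delta>) = \<delta>" "growth_inverse G \<delta> \<in> {0..}"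
    by (rule f_inv_into_f, rule inv_into_into)
  ultimately show ?thesis
    using assms(3) by (cases "growth_inverse G \<delta> = 0") auto
qed

lemma le_growth_inverse:
  assumes "strict_mono_on {0..} G" "bij_betw G {0..} {0..}" "r \<ge> 0" "G r \<le> \<delta>"
  shows "r \<le> growth_inverse G \<delta>"
proof -
  have img: "G ` {0..} = {0..}"
    using assms(2) by (simp add: bij_betw_def)
  have "G r \<ge> 0"
    using img assms(3) by fastforce
  then have "\<delta> \<in> G ` {0..}"
    using assms(4) img by simp
  then have "G (growth_inverse G \<delta>) = \<delta>" "growth_inverse G \<delta> \<in> {0..}"
    by (rule f_inv_into_f, rule inv_into_into)
  then show ?thesis
    using strict_mono_onD[OF assms(1), of "growth_inverse G \<delta>" r] assms(3,4) by force
qed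

text \<open>The index set under \<open>Min\<close> is finite and, by nonnegativity of
  \<open>K\<close>, contains \<open>0\<close>; so the minimum is attained by an actual
  iterate.\<close>

lemma decrement_guarantee_iterate:
  assumes "decrement_guarantee f fom K" "e > 0" "\<delta> \<ge> 2 * e" "D > 0"
    and "f x - min_value f \<ge> \<delta>" "infdist x (minimizers f) \<le> D"
  obtains j where "real j \<le> K e \<delta> D" "f (fom e x j) \<le> f x - e"
proof -
  let ?J = "{j. real j \<le> K e \<delta> D}"
  have nonneg: "K e \<delta> D \<ge> 0" and le: "Min ((\<lambda>j. f (fom e x j)) ` ?J) \<le> f x - e"
    using assms unfolding decrement_guarantee_def by blast+
  have "?J \<subseteq> {..nat \<lfloor>K e \<delta> D\<rfloor>}"
    by (auto simp: le_nat_floor)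
  then have "finite ?J"
    using finite_subset by blast
  moreover have "0 \<in> ?J"
    using nonneg by simp
  ultimately have "Min ((\<lambda>j. f (fom e x j)) ` ?J) \<in> (\<lambda>j. f (fom e x j)) ` ?J"
    by (intro Min_in) blast+
  then show ?thesis
    using le that by fastforce
qed

text \<open>\<open>c\<close> plays the role of the minimum value of \<open>f\<close>, and \<open>\<kappa> k\<close> bounds the number of iterations the
  method with target \<open>\<epsilon> k\<close> needs from a point of gap at least \<open>2 * \<epsilon> k\<close>.\<close>

locale restarting_run =
  fixes f :: "'a \<Rightarrow> real" and fom :: "'a fom" and \<epsilon> :: "nat \<Rightarrow> real" and N0 :: nat
    and x0 :: 'a and xbar :: "nat \<Rightarrow> 'a" and procs :: "nat \<Rightarrow> 'a process list"
    and c :: real and \<kappa> :: "nat \<Rightarrow> real"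
  assumes run: "dynamic_restarting_run f fom \<epsilon> N0 x0 xbar procs"
    and N0_pos: "N0 \<ge> 1"
    and eps_pos: "\<epsilon> k > 0"
    and iterate_0: "fom (\<epsilon> k) x 0 = x"
    and \<kappa>_nonneg: "\<kappa> k \<ge> 0"
    and decrement: "f x \<le> f x0 \<Longrightarrow> f x - c \<ge> 2 * \<epsilon> k \<Longrightarrow>
      \<exists>j. real j \<le> \<kappa> k \<and> f (fom (\<epsilon> k) x j) \<le> f x - \<epsilon> k"
begin

section \<open>Processes from one round to the next\<close>

abbreviation ref :: "nat \<Rightarrow> nat \<Rightarrow> 'a" where
  "ref t k \<equiv> reference (procs t ! k)"

abbreviation gap :: "nat \<Rightarrow> nat \<Rightarrow> real" where
  "gap t k \<equiv> f (ref t k) - c"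

lemma xbar_0: "xbar 0 = x0"
  and procs_0: "procs 0 = replicate N0 (Process x0 0)"
  and procs_Suc: "procs (Suc t) = next_processes f \<epsilon> (xbar (Suc t)) (procs t)"
  using run by (auto simp: dynamic_restarting_run_def)

lemma xbar_Suc_le:
  assumes "k < length (procs t)"
  shows "f (xbar (Suc t)) \<le> f (fom (\<epsilon> k) (ref t k) (Suc (age (procs t ! k))))"
proof -
  have "is_arg_min f (\<lambda>y. y \<in> new_iterates fom \<epsilon> (procs t)) (xbar (Suc t))"
    using run by (auto simp: dynamic_restarting_run_def)
  moreover have "fom (\<epsilon> k) (ref t k) (Suc (age (procs t ! k))) \<in> new_iterates fom \<epsilon> (procs t)"
    using assms by (auto simp: new_iterates_def)
  ultimately show ?thesis
    by (simp add: is_arg_min_linorder)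
qed

lemma length_procs_Suc: "length (procs t) \<le> length (procs (Suc t))"
  by (simp add: procs_Suc next_processes_def)

lemma length_procs_mono: "s \<le> t \<Longrightarrow> length (procs s) \<le> length (procs t)"
  by (rule lift_Suc_mono_le[of "\<lambda>t. length (procs t)"]) (rule length_procs_Suc)

lemma procs_nonempty: "procs t \<noteq> []"
  using length_procs_mono[of 0 t] N0_pos by (auto simp: procs_0)

lemma procs_Suc_old:
  assumes "k < length (procs t)"
  shows "procs (Suc t) ! k = update_process f (\<epsilon> k) (xbar (Suc t)) (procs t ! k)"
  using assms by (simp add: procs_Suc next_processes_def nth_append)

lemma procs_Suc_new:
  assumes "k < length (procs (Suc t))" "\<not> k < length (procs t)"
  shows "procs (Suc t) ! k = Process (xbar (Suc t)) 0"
  using assms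
  by (auto simp: procs_Suc next_processes_def nth_append less_Suc_eq split: if_splits)

lemma ref_Suc_cases:
  assumes "k < length (procs (Suc t))"
  obtains (fresh) "ref (Suc t) k = xbar (Suc t)" "age (procs (Suc t) ! k) = 0"
  | (continued) "k < length (procs t)" "ref (Suc t) k = ref t k"
      "age (procs (Suc t) ! k) = Suc (age (procs t ! k))"
      "f (xbar (Suc t)) > f (ref t k) - \<epsilon> k"
  using assms procs_Suc_old[of k t] procs_Suc_new[of k t]
  by (cases "k < length (procs t)")
    (auto simp: update_process_def accomplishes_task_def split: if_splits)

section \<open>Comparison of reference points and iterates\<close>

lemma f_ref_Suc_le: "k < length (procs t) \<Longrightarrow> f (ref (Suc t) k) \<le> f (ref t k)"
  using eps_pos[of k]
  by (auto simp: procs_Suc_old update_process_def accomplishes_task_def)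

lemma f_xbar_Suc_gt:
  assumes "k < length (procs t)"
  shows "f (ref (Suc t) k) < f (xbar (Suc t)) + \<epsilon> k"
  using assms eps_pos[of k]
  by (auto simp: procs_Suc_old update_process_def accomplishes_task_def)

lemma ref_is_xbar: "k < length (procs t) \<Longrightarrow> \<exists>u\<le>t. ref t k = xbar u"
proof (induction t)
  case 0
  then show ?case by (simp add: procs_0 xbar_0)
next
  case (Suc t)
  from Suc.prems show ?case
    by (cases rule: ref_Suc_cases) (use Suc.IH in \<open>auto intro: le_SucI\<close>)
qed

text \<open>\<open>xbar\<close> is at least as good as the newest iterate of every process, so an
  iterate with enough decrement would have reset the age.\<close>

lemma unfinished:
  "k < length (procs t) \<Longrightarrow> j \<le> age (procs t ! k) \<Longrightarrow> f (fom (\<epsilon> k) (ref t k) j) > f (ref t k) - \<epsilon> k"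
proof (induction t arbitrary: j)
  case 0
  then show ?case using eps_pos[of k] by (simp add: procs_0 iterate_0)
next
  case (Suc t)
  from Suc.prems(1) show ?case
  proof (cases rule: ref_Suc_cases)
    case fresh
    then show ?thesis using Suc.prems eps_pos[of k] by (simp add: iterate_0)
  next
    case continued
    then show ?thesis
      using Suc.IH[of j] Suc.prems(2) xbar_Suc_le[of k t] by (auto simp: le_Suc_eq)
  qed
qed

text \<open>At a reset of \<open>j\<close>, its new reference \<open>xbar\<close> is offered to
  \<open>i\<close> as well; between resets of \<open>j\<close>, the reference of \<open>i\<close>
  can only improve.\<close>

lemma ref_order:
  assumes "i < j" "j < length (procs t)"
  shows "f (ref t i) < f (ref t j) + \<epsilon> i"
  using assms(2)
proof (induction t)
  case 0
  then show ?case using assms(1) eps_pos[of i] by (simp add: procs_0)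
next
  case (Suc t)
  \<comment> \<open>At most one process is launched per round, so an index below \<open>j\<close>
    was present already.\<close>
  have i: "i < length (procs t)"
    using Suc.prems assms(1) length_procs_Suc[of t]
    by (auto simp: procs_Suc next_processes_def split: if_splits)
  from Suc.prems show ?case
  proof (cases rule: ref_Suc_cases)
    case fresh
    then show ?thesis using f_xbar_Suc_gt[OF i] by simp
  next
    case continued
    then show ?thesis using Suc.IH f_ref_Suc_le[OF i] by simp
  qed
qed

text \<open>\<open>decrement\<close> is available only below the level of \<open>x0\<close>. A
  launch respects this level because the point launched from accomplishes the task of the last
  process.\<close>

lemma f_ref_le_start: "k < length (procs t) \<Longrightarrow> f (ref t k) \<le> f x0"
proof (induction t arbitrary: k)
  case 0
  then show ?case by (simp add: procs_0)
next
  case (Suc t)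
  show ?case
  proof (cases "k < length (procs t)")
    case True
    then show ?thesis using Suc.IH f_ref_Suc_le by force
  next
    case False
    define l where "l = length (procs t) - 1"
    have l: "l < length (procs t)" "last (procs t) = procs t ! l"
      using procs_nonempty[of t] by (simp_all add: l_def last_conv_nth)
    have "accomplishes_task f (\<epsilon> l) (procs t ! l) (xbar (Suc t))"
      using Suc.prems False l by (auto simp: procs_Suc next_processes_def l_def split: if_splits)
    then have "f (xbar (Suc t)) \<le> f (ref t l)"
      using eps_pos[of l] by (simp add: accomplishes_task_def)
    then show ?thesis
      using procs_Suc_new[OF Suc.prems False] Suc.IH[OF l(1)] by simp
  qed
qed

section \<open>Time until the next restart\<close>

lemma restart_or_continue:
  assumes "k < length (procs t)"
  shows "(\<exists>s\<le>t + i. Suc k < length (procs s) \<and> f (ref s k) \<le> f (ref t k) - \<epsilon> k) \<or>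
    procs (t + i) ! k = Process (ref t k) (age (procs t ! k) + i)"
proof (induction i)
  case 0
  show ?case by simp
next
  case (Suc i)
  let ?s = "t + i"
  show ?case
  proof (cases "\<exists>s\<le>?s. Suc k < length (procs s) \<and> f (ref s k) \<le> f (ref t k) - \<epsilon> k")
    case True
    then show ?thesis by (auto intro: le_SucI)
  next
    case False
    with Suc have P: "procs ?s ! k = Process (ref t k) (age (procs t ! k) + i)"
      by blast
    have k: "k < length (procs ?s)"
      using assms length_procs_mono[of t ?s] by simp
    show ?thesis
    proof (cases "accomplishes_task f (\<epsilon> k) (procs ?s ! k) (xbar (Suc ?s))")
      case True
      then have "f (ref (Suc ?s) k) \<le> f (ref t k) - \<epsilon> k"
        using P by (simp add: procs_Suc_old[OF k] update_process_def accomplishes_task_def)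
      \<comment> \<open>If \<open>k\<close> is the highest index, its restart launches
        \<open>Suc k\<close>; otherwise that process exists already.\<close>
      moreover have "Suc k < length (procs (Suc ?s))"
      proof (cases "Suc k = length (procs ?s)")
        case True
        then have "last (procs ?s) = procs ?s ! k" "length (procs ?s) - 1 = k"
          using procs_nonempty[of ?s] by (simp_all add: last_conv_nth flip: True)
        then show ?thesis
          using True \<open>accomplishes_task _ _ _ _\<close> by (simp add: procs_Suc next_processes_def)
      next
        case False
        then show ?thesis using k length_procs_Suc[of ?s] by simp
      qed
      ultimately show ?thesis by (metis add_Suc_right order_refl)
    next
      case False
      then show ?thesis using P by (simp add: procs_Suc_old[OF k] update_process_def)
    qed
  qed
qed

lemma restart:
  assumes k: "k < length (procs t)" and gap: "gap t k \<ge> 2 * \<epsilon> k"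
  obtains s where "real s \<le> real t + \<kappa> k" "Suc k < length (procs s)" "gap s k \<le> gap t k - \<epsilon> k"
proof -
  obtain j where j: "real j \<le> \<kappa> k" "f (fom (\<epsilon> k) (ref t k) j) \<le> f (ref t k) - \<epsilon> k"
    using decrement[OF f_ref_le_start[OF k] gap] by blast
  let ?a = "age (procs t ! k)"
  \<comment> \<open>\<open>j\<close> counts from the last reset, not from round \<open>t\<close>:
    the iterates up to the current age have all failed, so only \<open>j - ?a\<close> rounds
    remain.\<close>
  have a: "?a < j"
    using unfinished[OF k] j(2) by (meson not_le)
  have "k < length (procs (t + (j - ?a)))"
    using k length_procs_mono[of t "t + (j - ?a)"] by linarith
  \<comment> \<open>Running on undisturbed would bring the age to \<open>j\<close>, against
    \<open>unfinished\<close>.\<close>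
  then have "procs (t + (j - ?a)) ! k \<noteq> Process (ref t k) (?a + (j - ?a))"
    using unfinished[of k "t + (j - ?a)" j] a j(2) by auto
  with restart_or_continue[OF k, of "j - ?a"] obtain s where
    "s \<le> t + (j - ?a)" "Suc k < length (procs s)" "f (ref s k) \<le> f (ref t k) - \<epsilon> k"
    by blast
  moreover have "real s \<le> real t + \<kappa> k"
    using \<open>s \<le> t + (j - ?a)\<close> j(1) by linarith
  ultimately show ?thesis
    using that by force
qed

section \<open>Descent of the gaps\<close>

lemma descend:
  assumes "k < length (procs t)" "gap t k < (real n + 2) * \<epsilon> k"
  shows "\<exists>s. real s \<le> real t + real n * \<kappa> k \<and> k < length (procs s) \<and> gap s k < 2 * \<epsilon> k"
  using assms
proof (induction n arbitrary: t)
  case 0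
  then show ?case by auto
next
  case (Suc n)
  show ?case
  proof (cases "gap t k < 2 * \<epsilon> k")
    case True
    then show ?thesis using Suc.prems \<kappa>_nonneg[of k] by (intro exI[of _ t]) simp
  next
    case False
    then have "gap t k \<ge> 2 * \<epsilon> k"
      by simp
    with Suc.prems(1) obtain s where s: "real s \<le> real t + \<kappa> k" "Suc k < length (procs s)"
        "gap s k \<le> gap t k - \<epsilon> k"
      by (rule restart)
    have "gap s k < (real n + 2) * \<epsilon> k"
      using s(3) Suc.prems(2) by (simp add: algebra_simps)
    then obtain u where "real u \<le> real s + real n * \<kappa> k" "k < length (procs u)" "gap u k < 2 * \<epsilon> k"
      using Suc.IH[of s] s(2) by auto
    then show ?thesis
      using s(1) by (intro exI[of _ u]) (simp add: algebra_simps)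
  qed
qed

lemma descend_from_next_target:
  assumes "k < length (procs t)" "gap t k < 2 * \<epsilon> (k + 1) + \<epsilon> k"
  obtains s where "real s \<le> real t + 2 * \<epsilon> (k + 1) / \<epsilon> k * \<kappa> k" "k < length (procs s)"
    "gap s k < 2 * \<epsilon> k"
proof -
  define q where "q = 2 * \<epsilon> (k + 1) / \<epsilon> k"
  \<comment> \<open>Rounding down is free: the gap is below \<open>(q + 1) * \<epsilon> k\<close>
    with \<open>q < n + 1\<close>, and \<open>n\<close> restarts suffice for any gap below
    \<open>(n + 2) * \<epsilon> k\<close>.\<close>
  define n where "n = nat \<lfloor>q\<rfloor>"
  have "q \<ge> 0"
    using eps_pos[of k] eps_pos[of "k + 1"] by (simp add: q_def)
  then have n: "real n \<le> q" "q < real n + 1"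
    unfolding n_def by linarith+
  have "gap t k < (q + 1) * \<epsilon> k"
    using assms(2) eps_pos[of k] by (simp add: q_def distrib_right)
  also have "\<dots> \<le> (real n + 2) * \<epsilon> k"
    using n eps_pos[of k] by (intro mult_right_mono) auto
  finally obtain s where s: "real s \<le> real t + real n * \<kappa> k" "k < length (procs s)" "gap s k < 2 * \<epsilon> k"
    using descend[OF assms(1)] by blast
  have "real n * \<kappa> k \<le> q * \<kappa> k"
    using n \<kappa>_nonneg by (intro mult_right_mono)
  then show ?thesis
    using s that[of s] by (simp add: q_def)
qed

lemma descend_to_zero:
  assumes "j < length (procs t)" "gap t j < 2 * \<epsilon> j"
  shows "\<exists>u. real u \<le> real t + (\<Sum>k<j. 2 * \<epsilon> (k + 1) / \<epsilon> k * \<kappa> k) \<and> f (xbar u) - c < 2 * \<epsilon> 0"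
  using assms
proof (induction j arbitrary: t)
  case 0
  \<comment> \<open>The gap bound concerns a reference point, which was \<open>xbar u\<close> in
    this or an earlier round.\<close>
  then obtain u where "u \<le> t" "ref t 0 = xbar u"
    using ref_is_xbar by blast
  with 0 show ?case by (intro exI[of _ u]) simp
next
  case (Suc k)
  have "gap t k < 2 * \<epsilon> (k + 1) + \<epsilon> k"
    using ref_order[of k "Suc k" t] Suc.prems by simp
  then obtain s where s: "real s \<le> real t + 2 * \<epsilon> (k + 1) / \<epsilon> k * \<kappa> k" "k < length (procs s)"
    "gap s k < 2 * \<epsilon> k"
    using descend_from_next_target[of k t] Suc.prems(1) Suc_lessD by blast
  from Suc.IH[OF s(2,3)] s(1) show ?case
    by force
qed

text \<open>The induction stays at an index once its gap is small, charging only the times below it;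
  otherwise a restart of \<open>j\<close> guarantees that \<open>Suc j\<close> is present.\<close>

lemma launch:
  "\<exists>t i. i \<le> j \<and> real t \<le> (\<Sum>k<i. \<kappa> k) \<and> i < length (procs t) \<and> (i = j \<or> gap t i < 2 * \<epsilon> i)"
proof (induction j)
  case 0
  show ?case using N0_pos by (intro exI[of _ 0]) (simp add: procs_0)
next
  case (Suc j)
  then obtain t i where ti: "i \<le> j" "real t \<le> (\<Sum>k<i. \<kappa> k)" "i < length (procs t)"
    "i = j \<or> gap t i < 2 * \<epsilon> i"
    by blast
  show ?case
  proof (cases "gap t i < 2 * \<epsilon> i")
    case True
    then show ?thesis using ti le_SucI by blast
  next
    case False
    then have "gap t i \<ge> 2 * \<epsilon> i"
      by simp
    with ti(3) obtain s where s: "real s \<le> real t + \<kappa> i" "Suc i < length (procs s)"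
      by (rule restart)
    have "i = j"
      using False ti(4) by blast
    with s ti(2) show ?thesis
      by (intro exI[of _ s] exI[of _ "Suc i"]) auto
  qed
qed

text \<open>\<open>launch\<close> is used only up to \<open>m - 1\<close>: no time is spent waiting
  for process \<open>m\<close>, so the sum stops before \<open>m\<close>.\<close>

theorem gap_below_first_target:
  assumes "0 < m" "f x0 - c \<le> 2 * \<epsilon> m"
  shows "\<exists>u. real u \<le> (\<Sum>k<m. (1 + 2 * \<epsilon> (k + 1) / \<epsilon> k) * \<kappa> k) \<and> f (xbar u) - c < 2 * \<epsilon> 0"
proof -
  let ?q = "\<lambda>k. 2 * \<epsilon> (k + 1) / \<epsilon> k * \<kappa> k"
  have q_nonneg: "?q k \<ge> 0" for k
    using \<kappa>_nonneg[of k] eps_pos[of k] eps_pos[of "k + 1"] by simp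
  obtain l where m: "m = Suc l"
    using assms(1) by (cases m) auto
  obtain t i where ti: "i \<le> l" "real t \<le> (\<Sum>k<i. \<kappa> k)" "i < length (procs t)"
    "i = l \<or> gap t i < 2 * \<epsilon> i"
    using launch by blast
  obtain s where s: "real s \<le> real t + ?q i" "i < length (procs s)" "gap s i < 2 * \<epsilon> i"
  proof (cases "gap t i < 2 * \<epsilon> i")
    case True
    then show ?thesis using that[of t] ti(3) q_nonneg[of i] by simp
  next
    case False
    \<comment> \<open>Here \<open>i = l\<close> and \<open>i + 1 = m\<close>: the initial gap, at
      most \<open>2 * \<epsilon> m\<close>, takes the place of a small gap at process
      \<open>m\<close>.\<close>
    then have "gap t i < 2 * \<epsilon> (i + 1) + \<epsilon> i"
      using ti(4) f_ref_le_start[OF ti(3)] assms(2) eps_pos[of i] by (auto simp: m)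
    then show ?thesis using descend_from_next_target[OF ti(3)] that by blast
  qed
  obtain u where u: "real u \<le> real s + (\<Sum>k<i. ?q k)" "f (xbar u) - c < 2 * \<epsilon> 0"
    using descend_to_zero[OF s(2,3)] by blast
  have "real u \<le> (\<Sum>k<i. \<kappa> k) + (\<Sum>k<Suc i. ?q k)"
    using u(1) s(1) ti(2) by simp
  also have "\<dots> \<le> (\<Sum>k<m. \<kappa> k) + (\<Sum>k<m. ?q k)"
    using ti(1) \<kappa>_nonneg q_nonneg by (intro add_mono sum_mono2) (auto simp: m)
  also have "\<dots> = (\<Sum>k<m. (1 + 2 * \<epsilon> (k + 1) / \<epsilon> k) * \<kappa> k)"
    by (simp add: sum.distrib algebra_simps)
  finally show ?thesis
    using u(2) by blast
qed

end

theorem corollary3p2: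
  fixes f :: "real ^ 'd \<Rightarrow> real"
    and fom :: "(real ^ 'd) fom"
    and K :: "real \<Rightarrow> real \<Rightarrow> real \<Rightarrow> real"
    and G :: "real \<Rightarrow> real"
    and \<epsilon> :: "nat \<Rightarrow> real"
    and N0 m :: nat
    and x0 :: "real ^ 'd"
    and xbar :: "nat \<Rightarrow> real ^ 'd"
    and procs :: "nat \<Rightarrow> (real ^ 'd) process list"
    and \<Delta>0 :: real
  assumes "convex_on UNIV f"
    and "minimizers f \<noteq> {}"
    and "first_order_method fom"
    and "decrement_guarantee f fom K"
    and "monotone_rate K"
    and "growth_condition f G x0"
    and "\<And>k. \<epsilon> k > 0"
    and "strict_mono \<epsilon>"
    and "filterlim \<epsilon> at_top sequentially"
    and "N0 \<ge> 1"
    and "\<Delta>0 = f x0 - min_value f"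
    and "m = Inf {k. \<epsilon> k \<ge> \<Delta>0 / 2}"
    and "\<And>e. e > 0 \<Longrightarrow> antimono_on {2 * e..} (\<lambda>\<delta>. K e \<delta> (growth_inverse G \<delta>))"
    and "dynamic_restarting_run f fom \<epsilon> N0 x0 xbar procs"
  shows "computes_by_round f xbar (2 * \<epsilon> 0)
    (\<Sum>k<m. (1 + 2 * \<epsilon> (k + 1) / \<epsilon> k) *
             K (\<epsilon> k) (2 * \<epsilon> k) (growth_inverse G (2 * \<epsilon> k)))"
proof -
  note bound = assms(4) and growth = assms(6)
  have G: "strict_mono_on {0..} G" "bij_betw G {0..} {0..}"
    and dist_le: "\<And>x. f x \<le> f x0 \<Longrightarrow> G (infdist x (minimizers f)) \<le> f x - min_value f"
    using growth by (auto simp: growth_condition_def)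
  define \<kappa> where "\<kappa> k = K (\<epsilon> k) (2 * \<epsilon> k) (growth_inverse G (2 * \<epsilon> k))" for k
  interpret restarting_run f fom \<epsilon> N0 x0 xbar procs "min_value f" \<kappa>
  proof
    show "dynamic_restarting_run f fom \<epsilon> N0 x0 xbar procs" "N0 \<ge> 1" "\<And>k. \<epsilon> k > 0"
      by fact+
    show "\<And>k x. fom (\<epsilon> k) x 0 = x"
      using assms(3,7) by (simp add: first_order_method_def)
    show "\<kappa> k \<ge> 0" for k
      using bound growth_inverse_pos[OF G, of "2 * \<epsilon> k"] assms(7)[of k]
      by (auto simp: decrement_guarantee_def \<kappa>_def)
    fix x k
    let ?\<delta> = "f x - min_value f"
    assume x: "f x \<le> f x0" and \<delta>: "?\<delta> \<ge> 2 * \<epsilon> k"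
    have "?\<delta> > 0"
      using \<delta> assms(7)[of k] by linarith
    then have D: "growth_inverse G ?\<delta> > 0"
      by (rule growth_inverse_pos[OF G])
    have "infdist x (minimizers f) \<le> growth_inverse G ?\<delta>"
      using le_growth_inverse[OF G infdist_nonneg dist_le[OF x]] .
    then obtain j where j: "real j \<le> K (\<epsilon> k) ?\<delta> (growth_inverse G ?\<delta>)"
        "f (fom (\<epsilon> k) x j) \<le> f x - \<epsilon> k"
      using decrement_guarantee_iterate[OF bound assms(7) \<delta> D order_refl] by blast
    \<comment> \<open>Both arguments of \<open>K\<close> move with the gap, so the comparison with
      \<open>2 * \<epsilon> k\<close> uses antitonicity along the curve
      \<open>D = growth_inverse G \<delta>\<close>.\<close>
    have "K (\<epsilon> k) ?\<delta> (growth_inverse G ?\<delta>) \<le> \<kappa> k"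
      unfolding \<kappa>_def using \<delta> by (intro monotone_onD[OF assms(13)[OF assms(7)[of k]]]) auto
    with j show "\<exists>j. real j \<le> \<kappa> k \<and> f (fom (\<epsilon> k) x j) \<le> f x - \<epsilon> k"
      by force
  qed
  \<comment> \<open>Divergence of the targets makes the index set nonempty, so \<open>Inf\<close> is
    attained and \<open>m\<close> itself satisfies the bound.\<close>
  have "eventually (\<lambda>k. \<epsilon> k \<ge> \<Delta>0 / 2) sequentially"
    using assms(9) unfolding filterlim_at_top by blast
  then have "{k. \<epsilon> k \<ge> \<Delta>0 / 2} \<noteq> {}"
    by (auto simp: eventually_sequentially)
  then have "m \<in> {k. \<epsilon> k \<ge> \<Delta>0 / 2}"
    unfolding assms(12) by (rule Inf_nat_def1)
  then have m: "f x0 - min_value f \<le> 2 * \<epsilon> m"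
    by (simp add: assms(11))
  show ?thesis
  proof (cases "m = 0")
    case True
    then show ?thesis
      using m xbar_0 by (auto simp: computes_by_round_def eta_optimal_def intro!: exI[of _ 0])
  next
    case False
    then obtain u where "real u \<le> (\<Sum>k<m. (1 + 2 * \<epsilon> (k + 1) / \<epsilon> k) * \<kappa> k)"
        "f (xbar u) - min_value f < 2 * \<epsilon> 0"
      using gap_below_first_target[OF _ m] by blast
    then show ?thesis
      unfolding computes_by_round_def eta_optimal_def \<kappa>_def by (intro exI[of _ u]) simp
  qed
qed

end
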